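(* Let $N\ge 1$ be an integer and let $\mathcal X=\{0,1,\dots,q-1\}$ with $q=|\mathcal X|\ge 2$. Let $M_3$ be the smallest integer $m$ for which there is at least one support-set $S\subseteq\mathcal X^N$ with $|S|=m$ that, for computing the bitwise OR of the informants' values, requires each of the $N$ informants to transmit, i.e. with $\#_n^{\mathrm{OR}}(S)=N$. Then $M_3=N+1$.
   Context: A support-set is a nonempty subset $S\subseteq \mathcal X^N$ (the support of a joint probability distribution of $N$ random variables with values in $\mathcal X$). For $x=(x_1,\dots,x_N)\in\mathcal X^N$ let $\mathrm{OR}(x)=x_1\vee x_2\vee\cdots\vee x_N$ be the bitwise OR of the binary representations of the nonnegative integers $x_1,\dots,x_N$. There are $N$ informants and a sink. A data-vector $x\in S$ is revealed to the informants, informant $i$ seeing only $x_i$; only the sink knows $S$. The sink must learn the value $\mathrm{OR}(x)$ by interactively querying informants: it queries one informant at a time, a queried informant $i$ reports its value $x_i$ to the sink, and the choice of the next informant to query (or the decision to stop) may depend on $S$ and on all the values reported so far. The sink stops when all elements of $S$ consistent with the reported values have the same value of $\mathrm{OR}$ (possibly without any query). Such a querying strategy is a deterministic adaptive protocol for $S$. For a protocol, its worst-case number of queried informants is the maximum, over $x\in S$, of the number of distinct informants queried when the data-vector is $x$. Define $\#_n^{\mathrm{OR}}(S)$ as the minimum over all protocols for $S$ of the worst-case number of queried informants. The support-set $S$ is said to require, for computing bitwise OR, each of the $N$ informants to transmit if $\#_n^{\mathrm{OR}}(S)=N$. *)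

theory Defs
  imports Main
begin

text \<open>The informants are numbered from \<open>0\<close>: a data-vector \<open>x\<close> is a list of length \<open>N\<close>, and
  informant \<open>i < N\<close> sees \<open>x ! i\<close>.\<close>

definition data_vectors :: "nat \<Rightarrow> nat \<Rightarrow> nat list set" where
  "data_vectors q N = {x. length x = N \<and> set x \<subseteq> {0..<q}}"

definition support_set :: "nat \<Rightarrow> nat \<Rightarrow> nat list set \<Rightarrow> bool" where
  "support_set q N S \<longleftrightarrow> S \<noteq> {} \<and> S \<subseteq> data_vectors q N"

definition OR_all :: "nat list \<Rightarrow> nat" where
  "OR_all x = foldr Bit_Operations.or x 0"

definition determined :: "nat list set \<Rightarrow> bool" where
  "determined C \<longleftrightarrow> (\<forall>x\<in>C. \<forall>y\<in>C. OR_all x = OR_all y)"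

text \<open>A deterministic adaptive querying strategy is a well-founded decision tree:
  \<open>Query i f\<close> queries informant \<open>i\<close> and, on the reported value \<open>v\<close>, continues with \<open>f v\<close>.\<close>

datatype strategy = Stop | Query nat "nat \<Rightarrow> strategy"

text \<open>The argument \<open>C\<close> is the set of the elements of the support-set that are consistent with the
  values reported so far; initially it is the support-set itself. The sink stops exactly when
  \<open>C\<close> determines the value of the OR. Querying an informant repeatedly is allowed. Only reports
  that can occur are constrained.\<close>

primrec protocol_for :: "nat \<Rightarrow> strategy \<Rightarrow> nat list set \<Rightarrow> bool" where
  "protocol_for N Stop C \<longleftrightarrow> determined C"
| "protocol_for N (Query i f) C \<longleftrightarrow>
     \<not> determined C \<and> i < N \<and>
     (\<forall>v. v \<in> (\<lambda>x. x ! i) ` C \<longrightarrow> protocol_for N (f v) {x \<in> C. x ! i = v})"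

primrec queried :: "strategy \<Rightarrow> nat list \<Rightarrow> nat set" where
  "queried Stop x = {}"
| "queried (Query i f) x = insert i (queried (f (x ! i)) x)"

definition worst_case :: "nat list set \<Rightarrow> strategy \<Rightarrow> nat" where
  "worst_case S t = Max ((\<lambda>x. card (queried t x)) ` S)"

definition num_OR :: "nat \<Rightarrow> nat list set \<Rightarrow> nat" where
  "num_OR N S = (LEAST k. \<exists>t. protocol_for N t S \<and> worst_case S t = k)"

definition requires_all :: "nat \<Rightarrow> nat list set \<Rightarrow> bool" where
  "requires_all N S \<longleftrightarrow> num_OR N S = N"

definition M3 :: "nat \<Rightarrow> nat \<Rightarrow> nat" where
  "M3 q N = (LEAST m. \<exists>S. support_set q N S \<and> card S = m \<and> requires_all N S)"

end

(* An undetermined set of candidates contains two vectors with different ORs; querying a coordinate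
   in which they differ strictly shrinks the candidate set whatever the answer is, so card S - 1
   queries always suffice.  Conversely, let S consist of the zero vector and the N unit vectors: on
   the zero vector, an informant who is never queried leaves his unit vector possible, and
   its OR is 1 instead of 0. *)

theory Submission imports Defs begin

text \<open>Makes every support-set finite, so that \<open>card\<close> and \<open>Max\<close> over
  it are meaningful.\<close>

lemma finite_data_vectors: "finite (data_vectors q N)"
  using finite_lists_length_eq[of "{0..<q}" N] by (simp add: data_vectors_def conj_commute)

lemma OR_all_eq_0_iff: "OR_all x = 0 \<longleftrightarrow> (\<forall>v\<in>set x. v = 0)"
  by (induction x) (auto simp: OR_all_def or_eq_0_iff)

text \<open>The bound is stated for each vector rather than for \<open>worst_case\<close>, so that
  the induction can apply it separately below each answer.\<close>

lemma short_protocol_exists: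
  assumes "finite C" "C \<noteq> {}" "\<forall>x\<in>C. length x = N"
  shows "\<exists>t. protocol_for N t C \<and> (\<forall>x\<in>C. card (queried t x) < card C)"
  using assms
proof (induction C rule: finite_psubset_induct)
  case (psubset C)
  show ?case
  proof (cases "determined C")
    case True
    with psubset.hyps psubset.prems show ?thesis
      by (intro exI[of _ Stop]) (auto simp: card_gt_0_iff)
  next
    case False
    then obtain x y where xy: "x \<in> C" "y \<in> C" "x \<noteq> y"
      unfolding determined_def by metis
    then obtain i where i: "i < N" "x ! i \<noteq> y ! i"
      using psubset.prems nth_equalityI by metis
    have sub: "{z \<in> C. z ! i = v} \<subset> C" for v
    proof -
      have "x \<notin> {z \<in> C. z ! i = v} \<or> y \<notin> {z \<in> C. z ! i = v}"
        using i by auto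
      then show ?thesis using xy by blast
    qed
    \<comment> \<open>Only answers that occur get a subtree from the induction hypothesis, because
      it needs a nonempty candidate set.\<close>
    have "\<forall>v\<in>(\<lambda>x. x ! i) ` C. \<exists>t. protocol_for N t {z \<in> C. z ! i = v} \<and>
        (\<forall>z\<in>{z \<in> C. z ! i = v}. card (queried t z) < card {z \<in> C. z ! i = v})"
    proof (intro ballI psubset.IH[OF sub])
      fix v assume "v \<in> (\<lambda>x. x ! i) ` C"
      then show "{z \<in> C. z ! i = v} \<noteq> {}" by blast
    qed (use psubset.prems in simp)
    from bchoice[OF this] obtain f where
      f: "\<forall>v\<in>(\<lambda>x. x ! i) ` C. protocol_for N (f v) {z \<in> C. z ! i = v} \<and>
        (\<forall>z\<in>{z \<in> C. z ! i = v}. card (queried (f v) z) < card {z \<in> C. z ! i = v})"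
      by (elim exE)
    have "card (queried (Query i f) z) < card C" if "z \<in> C" for z
    proof -
      \<comment> \<open>Only an inequality, as the subtree may query \<open>i\<close> again. The
        extra query is then absorbed by the strict bound of the induction hypothesis.\<close>
      have "card (queried (Query i f) z) \<le> Suc (card (queried (f (z ! i)) z))"
        by (simp add: card_insert_le_m1)
      also have "\<dots> \<le> card {w \<in> C. w ! i = z ! i}"
        using f that by (simp add: Suc_le_eq)
      also have "\<dots> < card C"
        using sub psubset.hyps by (rule psubset_card_mono[rotated])
      finally show ?thesis .
    qed
    moreover have "protocol_for N (Query i f) C"
      using False i f by auto
    ultimately show ?thesis by blast
  qed
qed

lemma queried_subset:
  assumes "protocol_for N t C" "x \<in> C"
  shows "queried t x \<subseteq> {..<N}"
  using assms
proof (induction t arbitrary: C)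
  case Stop
  then show ?case by simp
next
  case (Query i f)
  have "queried (f (x ! i)) x \<subseteq> {..<N}"
    by (rule Query.IH[of "f (x ! i)" "{z \<in> C. z ! i = x ! i}"]) (use Query.prems in auto)
  then show ?case using Query.prems by simp
qed

text \<open>Equal reports lead both vectors down the same branch, so both are still candidates at
  its leaf, where the OR is determined.\<close>

lemma OR_all_eq_if_agree_on_queried:
  assumes "protocol_for N t C" "x \<in> C" "y \<in> C" "\<forall>i\<in>queried t x. x ! i = y ! i"
  shows "OR_all x = OR_all y"
  using assms
proof (induction t arbitrary: C)
  case Stop
  then show ?case unfolding determined_def protocol_for.simps by blast
next
  case (Query i f)
  show ?case
    by (rule Query.IH[of "f (x ! i)" "{z \<in> C. z ! i = x ! i}"]) (use Query.prems in auto)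
qed

text \<open>Yields the lower bound on \<open>M3\<close>: a set with \<open>num_OR N S = N\<close>
  has more than \<open>N\<close> elements.\<close>

lemma num_OR_less_card:
  assumes "support_set q N S"
  shows "num_OR N S < card S"
proof -
  have S: "finite S" "S \<noteq> {}" "\<forall>x\<in>S. length x = N"
    using assms finite_subset[OF _ finite_data_vectors]
    by (auto simp: support_set_def data_vectors_def)
  obtain t where t: "protocol_for N t S" "\<forall>x\<in>S. card (queried t x) < card S"
    using short_protocol_exists[OF S] by blast
  have "num_OR N S \<le> worst_case S t"
    unfolding num_OR_def by (rule Least_le) (use t in blast)
  also have "\<dots> < card S"
    using S t by (simp add: worst_case_def)
  finally show ?thesis .
qed

definition zero_and_units :: "nat \<Rightarrow> nat list set" where
  "zero_and_units N = insert (replicate N 0) ((\<lambda>i. (replicate N 0)[i := 1]) ` {..<N})"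

lemma support_set_zero_and_units:
  assumes "q \<ge> 2"
  shows "support_set q N (zero_and_units N)"
proof -
  \<comment> \<open>The update adds at most the entry 1, which is a legal value because
    \<open>q \<ge> 2\<close>.\<close>
  have "set ((replicate N (0::nat))[i := 1]) \<subseteq> {0..<q}" for i
    using set_update_subset_insert[of "replicate N 0" i "1::nat"] assms
    by (auto split: if_splits)
  then show ?thesis
    using assms by (auto simp: support_set_def zero_and_units_def data_vectors_def)
qed

lemma card_zero_and_units_le: "card (zero_and_units N) \<le> N + 1"
proof -
  have "card (zero_and_units N) \<le> Suc (card ((\<lambda>i. (replicate N (0::nat))[i := 1]) ` {..<N}))"
    unfolding zero_and_units_def by (simp add: card_insert_le_m1)
  also have "\<dots> \<le> N + 1"
    using card_image_le[of "{..<N}"] by simp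
  finally show ?thesis .
qed

lemma queried_zero:
  assumes "protocol_for N t (zero_and_units N)"
  shows "queried t (replicate N 0) = {..<N}"
proof
  let ?z = "replicate N (0::nat)"
  have z: "?z \<in> zero_and_units N" by (simp add: zero_and_units_def)
  show "queried t ?z \<subseteq> {..<N}" using queried_subset[OF assms z] .
  show "{..<N} \<subseteq> queried t ?z"
  proof (rule ccontr)
    assume "\<not> {..<N} \<subseteq> queried t ?z"
    then obtain i where i: "i < N" "i \<notin> queried t ?z" by auto
    \<comment> \<open>The two vectors differ only at \<open>i\<close>, which is not queried on
      \<open>?z\<close>.\<close>
    have "OR_all ?z = OR_all (?z[i := 1])"
    proof (rule OR_all_eq_if_agree_on_queried[OF assms z])
      show "?z[i := 1] \<in> zero_and_units N" using i by (simp add: zero_and_units_def)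
      show "\<forall>j\<in>queried t ?z. ?z ! j = ?z[i := 1] ! j"
        using i by (metis nth_list_update_neq)
    qed
    moreover have "OR_all ?z = 0" by (simp add: OR_all_eq_0_iff)
    moreover have "1 \<in> set (?z[i := 1])" using i by (simp add: set_update_memI)
    ultimately show False by (metis OR_all_eq_0_iff one_neq_zero)
  qed
qed

text \<open>The zero vector attains \<open>N\<close>, and no vector exceeds it since all queried
  informants lie below \<open>N\<close>. As this holds for every protocol, \<open>N\<close> is the
  only candidate for the minimum in \<open>num_OR\<close>.\<close>

lemma worst_case_zero_and_units:
  assumes "protocol_for N t (zero_and_units N)"
  shows "worst_case (zero_and_units N) t = N"
  unfolding worst_case_def
proof (rule Max_eqI)
  show "finite ((\<lambda>x. card (queried t x)) ` zero_and_units N)"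
    by (simp add: zero_and_units_def)
  show "k \<le> N" if "k \<in> (\<lambda>x. card (queried t x)) ` zero_and_units N" for k
    using that card_mono[OF finite_lessThan queried_subset[OF assms]] by auto
  show "N \<in> (\<lambda>x. card (queried t x)) ` zero_and_units N"
    using queried_zero[OF assms] by (auto simp: zero_and_units_def)
qed

lemma requires_all_zero_and_units: "requires_all N (zero_and_units N)"
proof -
  have "finite (zero_and_units N)" "zero_and_units N \<noteq> {}"
    "\<forall>x\<in>zero_and_units N. length x = N"
    by (auto simp: zero_and_units_def)
  \<comment> \<open>Some protocol must exist for the value \<open>N\<close> to be attained;
    otherwise \<open>LEAST\<close> would range over nothing.\<close>
  then obtain t where "protocol_for N t (zero_and_units N)"
    using short_protocol_exists by blast
  then show ?thesis
    unfolding requires_all_def num_OR_def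
    by (intro Least_equality) (auto intro: worst_case_zero_and_units simp: worst_case_zero_and_units)
qed

theorem lemma6:
  fixes N q :: nat
  assumes "N \<ge> 1" and "q \<ge> 2"
  shows "(\<exists>S. support_set q N S \<and> requires_all N S) \<and> M3 q N = N + 1"
proof
  note support = support_set_zero_and_units[OF \<open>q \<ge> 2\<close>, of N]
  have lower: "N + 1 \<le> card S" if "support_set q N S" "requires_all N S" for S
    using num_OR_less_card[OF that(1)] that(2) by (simp add: requires_all_def)
  \<comment> \<open>The general lower bound, applied to this very set, shows that its
    \<open>N + 1\<close> listed vectors are distinct.\<close>
  have "card (zero_and_units N) = N + 1"
    using lower[OF support requires_all_zero_and_units] card_zero_and_units_le
    by (rule antisym[rotated])
  then show "M3 q N = N + 1"
    unfolding M3_def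
    using support requires_all_zero_and_units lower by (intro Least_equality) auto
  show "\<exists>S. support_set q N S \<and> requires_all N S"
    using support requires_all_zero_and_units by blast
qed

end
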